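(* Let $(d_k:k\geq1)$ and $(N_k:k\geq1)$ be sequences of positive integers. Suppose there are $\alpha>0$, $\beta>0$ and an integer $s\geq0$ such that, for all $k$, $d_{k+1}\geq(1+\alpha)d_k$ and $d_k\leq\beta N_{k+s}$. Then there is a constant $c>0$, depending only on $s$, $\alpha$ and $\sup_k d_k/N_{k+s}$, such that for every sequence $(f_k:k\geq1)$ with $f_k\in H^1_{d_k}(\mathbb{D})$, $$\big\|(\mathbb{E}^*_{N_k}|f_k|)_{k=1}^\infty\big\|_{\mathrm{ind}}\leq c\,\big\|(f_k)_{k=1}^\infty\big\|_{L^1(\ell^2)}.$$
   Context: $\mathbb{T}$ is identified with $[0,1)$, with addition modulo $1$ and Lebesgue measure $\mu$. Define $H^1_n(\mathbb{D})=\mathrm{span}\{e^{2\pi ijt}:0\leq j\leq n\}$. For $x_0\in\mathbb{T}$ set $\tau_{x_0}f(x)=f(x-x_0)$, and set $\mathbb{E}^*_N=\frac1N\sum_{j=0}^{N-1}\tau_{j/N}$. For a sequence $(g_k)$ of functions on $\mathbb{T}$, define $$\|(g_k)\|_{L^1(\ell^2)}=\int_{\mathbb{T}}\Big(\sum_k|g_k(t)|^2\Big)^{1/2}dt$$ and $$\|(g_k)\|_{\mathrm{ind}}=\int_{\mathbb{T}^\infty}\Big(\sum_k|g_k(\omega_k)|^2\Big)^{1/2}d\mu^{\otimes\infty}(\omega).$$ In the second norm each $g_k$ is evaluated at an independent coordinate $\omega_k$. *)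

theory Defs
  imports "HOL-Probability.Probability"
begin

text \<open>The torus T = [0,1) with Lebesgue measure; functions on T are represented
  as 1-periodic functions on the reals.\<close>
definition torus_measure :: "real measure" where
  "torus_measure = restrict_space lborel {0..<1}"

definition H1 :: "nat \<Rightarrow> (real \<Rightarrow> complex) set" where
  "H1 n = {f. \<exists>a :: nat \<Rightarrow> complex. \<forall>t. f t = (\<Sum>j\<le>n. a j * exp (2 * pi * \<i> * of_nat j * of_real t))}"

definition Estar :: "nat \<Rightarrow> (real \<Rightarrow> real) \<Rightarrow> real \<Rightarrow> real" where
  "Estar N g x = (1 / real N) * (\<Sum>j<N. g (x - real j / real N))"

definition l2norm :: "(nat \<Rightarrow> real) \<Rightarrow> ennreal" where
  "l2norm x = (SUP n. ennreal (sqrt (\<Sum>k\<in>{1..n}. (x k)\<^sup>2)))"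

definition L1l2_norm :: "(nat \<Rightarrow> real \<Rightarrow> real) \<Rightarrow> ennreal" where
  "L1l2_norm g = (\<integral>\<^sup>+ t. l2norm (\<lambda>k. g k t) \<partial>torus_measure)"

definition ind_norm :: "(nat \<Rightarrow> real \<Rightarrow> real) \<Rightarrow> ennreal" where
  "ind_norm g = (\<integral>\<^sup>+ \<omega>. l2norm (\<lambda>k. g k (\<omega> k)) \<partial>(PiM (UNIV :: nat set) (\<lambda>_. torus_measure)))"

end

theory Submission
  imports Defs
begin

text \<open>Write \<open>X\<^sub>k = E\<^sup>*\<^bsub>N\<^sub>k\<^esub>|f\<^sub>k|\<close>, let \<open>S\<^sub>k\<close> be the partial square function
  \<open>sqrt (\<Sum>j\<le>k. |f\<^sub>j|\<^sup>2)\<close>, let \<open>\<lambda>\<close> be the norm of \<open>(f\<^sub>k)\<close> in \<open>L\<^sup>1(\<ell>\<^sup>2)\<close> and put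
  \<open>u\<^sub>k = min 1 (X\<^sub>k / \<lambda>)\<close>. Pointwise, the \<open>\<ell>\<^sup>2\<close> norm of \<open>(X\<^sub>k)\<close> is at most
  \<open>\<lambda> + \<Sum> X\<^sub>k u\<^sub>k\<close>, so only one-dimensional integrals remain on the left, and
  \<open>\<integral>X\<^sub>k u\<^sub>k = \<integral>|f\<^sub>k| u\<^sub>k\<close> because \<open>u\<^sub>k\<close> has period \<open>1/N\<^sub>k\<close>. As in the proof of the
  duality between \<open>H\<^sup>1\<close> and BMO for martingales, Cauchy-Schwarz with weight \<open>S\<^sub>k\<close> bounds
  \<open>\<Sum>|f\<^sub>k| u\<^sub>k\<close> by the increments of \<open>S\<close> and \<open>\<Sum>S\<^sub>k u\<^sub>k\<^sup>2\<close>. Replacing \<open>S\<^sub>k\<close> by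
  \<open>S\<^bsub>k-s\<^esub>\<close> in the latter costs \<open>s\<lambda>\<close>, and \<open>S\<^bsub>k-s\<^esub>\<close> decouples from \<open>u\<^sub>k\<^sup>2\<close>, since it is
  built from polynomials of degree \<open>O(N\<^sub>k)\<close> and hence its averages over translates by
  multiples of \<open>1/N\<^sub>k\<close> are pointwise \<open>O(\<lambda>)\<close>. Finally \<open>\<lambda> u\<^sub>k\<^sup>2 \<le> X\<^sub>k u\<^sub>k\<close> lets the sum of
  \<open>\<integral>u\<^sub>k\<^sup>2\<close> be absorbed.\<close>

subsection \<open>A reproducing kernel for analytic polynomials\<close>

text \<open>Frequencies are integers, since products with conjugate characters produce negative
  ones.\<close>

definition echar :: "int \<Rightarrow> real \<Rightarrow> complex" where
  "echar m t = cis (2 * pi * of_int m * t)"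

lemma echar_0 [simp]: "echar 0 t = 1"
  by (simp add: echar_def)

lemma norm_echar [simp]: "cmod (echar m t) = 1"
  by (simp add: echar_def)

lemma cnj_echar: "cnj (echar m t) = echar (- m) t"
  by (simp add: echar_def cis_cnj)

lemma echar_add: "echar (m + n) t = echar m t * echar n t"
  by (simp add: echar_def cis_mult algebra_simps)

lemma echar_diff_right: "echar m (t - y) = echar m t * echar (- m) y"
  by (simp add: echar_def cis_mult algebra_simps)

lemma echar_plus_one [simp]: "echar m (t + 1) = echar m t"
proof -
  have "echar m (t + 1) = echar m t * cis (2 * pi * of_int m)"
    by (simp add: echar_def cis_mult algebra_simps)
  then show ?thesis
    by (simp add: cis_multiple_2pi)
qed

lemma continuous_on_echar [continuous_intros]:
  "continuous_on A g \<Longrightarrow> continuous_on A (\<lambda>x. echar m (g x))"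
  unfolding echar_def by (intro continuous_intros)

lemma has_integral_echar: "(echar m has_integral (if m = 0 then 1 else 0)) {0..1}"
proof (cases "m = 0")
  case True
  then show ?thesis
    using has_integral_const_real[of "1::complex" 0 1] by (simp add: echar_def[abs_def])
next
  case False
  define c where "c = 2 * pi * of_int m"
  have c: "c \<noteq> 0" using False by (simp add: c_def)
  have echar: "echar m = (\<lambda>t. exp (\<i> * of_real (c * t)))"
    by (auto simp: echar_def c_def cis_conv_exp)
  have "((\<lambda>t. exp (\<i> * of_real (c * t)) / (\<i> * of_real c)) has_vector_derivative
            exp (\<i> * of_real (c * t))) (at t within {0..1})" for t
  proof -
    have "((\<lambda>z. exp (\<i> * (of_real c * z)) / (\<i> * of_real c)) has_field_derivative
        exp (\<i> * (of_real c * of_real t))) (at (of_real t))"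
      using c by (auto intro!: derivative_eq_intros simp: mult_ac complex_i_mult_minus)
    from has_vector_derivative_real_field[OF this] show ?thesis by simp
  qed
  then have "(echar m has_integral (exp (\<i> * of_real (c * 1)) / (\<i> * of_real c)
      - exp (\<i> * of_real (c * 0)) / (\<i> * of_real c))) {0..1}"
    unfolding echar by (intro fundamental_theorem_of_calculus) auto
  moreover have "exp (\<i> * of_real (c * 1)) = 1"
    using cis_multiple_2pi[of "of_int m"] by (simp add: c_def cis_conv_exp)
  ultimately show ?thesis using False by simp
qed

lemma H1E:
  assumes "f \<in> H1 d"
  obtains c where "f = (\<lambda>t. \<Sum>m\<le>d. c m * echar (int m) t)"
proof -
  from assms obtain c where
    "\<And>t. f t = (\<Sum>j\<le>d. c j * exp (2 * pi * \<i> * of_nat j * of_real t))"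
    by (auto simp: H1_def)
  then have "f = (\<lambda>t. \<Sum>m\<le>d. c m * echar (int m) t)"
    by (auto simp: echar_def cis_conv_exp mult_ac)
  then show ?thesis ..
qed

lemma H1_mono: "m \<le> n \<Longrightarrow> H1 m \<subseteq> H1 n"
proof
  fix f assume mn: "m \<le> n" and "f \<in> H1 m"
  then obtain a where a: "\<And>t. f t = (\<Sum>j\<le>m. a j * exp (2 * pi * \<i> * of_nat j * of_real t))"
    by (auto simp: H1_def)
  have "f t = (\<Sum>j\<le>n. (if j \<le> m then a j else 0) * exp (2 * pi * \<i> * of_nat j * of_real t))" for t
    unfolding a using mn by (intro sum.mono_neutral_cong_left) auto
  then show "f \<in> H1 n" unfolding H1_def
    by (auto intro!: exI[of _ "\<lambda>j. if j \<le> m then a j else 0"])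
qed

lemma continuous_on_H1: "f \<in> H1 d \<Longrightarrow> continuous_on A f"
  by (erule H1E) (auto intro!: continuous_intros)

lemma H1_plus_one: "f \<in> H1 d \<Longrightarrow> f (t + 1) = f t"
  by (erule H1E) simp

text \<open>One-sided Dirichlet kernel; for \<open>n > 0\<close> the quotient
  \<open>(cmod (dker n y))\<^sup>2 / n\<close> is the Fejer kernel of order
  \<open>n\<close>.\<close>

definition dker :: "nat \<Rightarrow> real \<Rightarrow> complex" where
  "dker n y = (\<Sum>a<n. echar (int a) y)"

text \<open>The coefficient of \<open>vker d\<close> at a frequency \<open>m\<close> is
  \<open>1/d\<close> times the number of pairs \<open>a < d\<close>, \<open>b < 2d\<close> with \<open>b - a = m\<close>, hence \<open>1\<close> for
  \<open>0 \<le> m \<le> d\<close>.\<close>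

definition vker :: "nat \<Rightarrow> real \<Rightarrow> complex" where
  "vker d y = cnj (dker d y) * dker (2 * d) y / of_nat d"

text \<open>Nonnegative majorant of \<open>cmod (vker d y)\<close> obtained from the inequality of
  the means. For \<open>d > 0\<close> it is half the Fejer kernel of order \<open>d\<close> plus the
  Fejer kernel of order \<open>2 * d\<close>.\<close>

definition wker :: "nat \<Rightarrow> real \<Rightarrow> real" where
  "wker d y = ((cmod (dker d y))\<^sup>2 + (cmod (dker (2 * d) y))\<^sup>2) / (2 * real d)"

lemma continuous_on_dker [continuous_intros]:
  "continuous_on A g \<Longrightarrow> continuous_on A (\<lambda>x. dker n (g x))"
  unfolding dker_def by (intro continuous_intros)

lemma continuous_on_wker [continuous_intros]:
  "continuous_on A g \<Longrightarrow> continuous_on A (\<lambda>x. wker n (g x))"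
  unfolding wker_def divide_inverse by (intro continuous_intros)

lemma norm_vker_le: "cmod (vker d y) \<le> wker d y"
proof -
  have "2 * (cmod (dker d y) * cmod (dker (2 * d) y))
      \<le> (cmod (dker d y))\<^sup>2 + (cmod (dker (2 * d) y))\<^sup>2"
    using sum_squares_bound[of "cmod (dker d y)" "cmod (dker (2 * d) y)"] by simp
  then show ?thesis
    by (cases "d = 0")
       (auto simp: vker_def wker_def norm_mult norm_divide field_simps)
qed

text \<open>Convolution multiplies each frequency by the corresponding coefficient of the kernel,
  which is 1 for all frequencies from 0 to \<open>d\<close>. Both factors are expanded into
  characters and integrated term by term.\<close>

lemma H1_reproducing:
  assumes f: "f \<in> H1 d" and d: "d > 0"
  shows "((\<lambda>y. f y * vker d (t - y)) has_integral f t) {0..1}"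
proof -
  from f obtain c where c: "f = (\<lambda>t. \<Sum>m\<le>d. c m * echar (int m) t)" by (rule H1E)
  define g where "g m a b = c m / of_nat d * echar (int b - int a) t" for m a b
  have "f y * vker d (t - y)
      = (\<Sum>m\<le>d. \<Sum>a<d. \<Sum>b<2*d. g m a b * echar (int m + int a - int b) y)" for y
  proof -
    have "c m * echar (int m) y * (cnj (echar (int a) (t - y)) * echar (int b) (t - y)) / of_nat d
        = g m a b * echar (int m + int a - int b) y" for m a b
      using echar_add[of "int b" "- int a" t] echar_add[of "int m + int a" "- int b" y]
        echar_add[of "int m" "int a" y]
      by (simp add: g_def cnj_echar echar_diff_right)
    then show ?thesis
      by (simp add: c vker_def dker_def sum_product sum_divide_distrib mult.assoc
          flip: sum_distrib_left)
         (simp add: sum_distrib_left sum_distrib_right sum_divide_distrib sum_product mult.assoc)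
  qed
  moreover have "((\<lambda>y. \<Sum>m\<le>d. \<Sum>a<d. \<Sum>b<2*d. g m a b * echar (int m + int a - int b) y)
      has_integral (\<Sum>m\<le>d. \<Sum>a<d. \<Sum>b<2*d. g m a b * (if int m + int a - int b = 0 then 1 else 0))) {0..1}"
    by (intro has_integral_sum has_integral_mult_right has_integral_echar) auto
  moreover have "(\<Sum>m\<le>d. \<Sum>a<d. \<Sum>b<2*d. g m a b * (if int m + int a - int b = 0 then 1 else 0)) = f t"
  proof -
    have "(\<Sum>b<2*d. g m a b * (if int m + int a - int b = 0 then 1 else 0))
        = c m / of_nat d * echar (int m) t" if "m \<le> d" "a < d" for m a
    proof -
      have "(\<Sum>b<2*d. g m a b * (if int m + int a - int b = 0 then 1 else 0))
          = (\<Sum>b<2*d. if b = m + a then g m a b else 0)"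
        by (intro sum.cong) auto
      \<comment> \<open>The index \<open>m + a\<close> lies in range because
        \<open>m \<le> d\<close> and \<open>a < d\<close>; this is why the second Dirichlet factor
        has length \<open>2 * d\<close>.\<close>
      also have "\<dots> = g m a (m + a)" using that by (simp add: sum.delta')
      finally show ?thesis by (simp add: g_def)
    qed
    then have "(\<Sum>m\<le>d. \<Sum>a<d. \<Sum>b<2*d. g m a b * (if int m + int a - int b = 0 then 1 else 0))
        = (\<Sum>m\<le>d. \<Sum>a<d. c m / of_nat d * echar (int m) t)"
      by (intro sum.cong) auto
    then show ?thesis using d by (simp add: c)
  qed
  ultimately show ?thesis by simp
qed

section \<open>Averages of characters and kernels over translates by multiples of
  \<open>1 / N\<close>\<close>

lemma Estar_echar:
  assumes N: "N > 0"
  shows "cmod ((\<Sum>j<N. echar m (x - real j / real N)) / of_nat N) \<le> (if int N dvd m then 1 else 0)"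
proof -
  \<comment> \<open>The translates form a geometric progression whose ratio \<open>z\<close> is an
    \<open>N\<close>-th root of unity. It differs from 1 when \<open>N\<close> does not divide
    \<open>m\<close>, and then the sum vanishes.\<close>
  define z where "z = echar (- m) (1 / real N)"
  have "echar (- m) (real j / real N) = z ^ j" for j
    unfolding z_def echar_def Complex.DeMoivre by (rule arg_cong[where f = cis]) simp
  then have *: "(\<Sum>j<N. echar m (x - real j / real N)) = echar m x * (\<Sum>j<N. z ^ j)"
    by (simp add: echar_diff_right sum_distrib_left)
  show ?thesis
  proof (cases "int N dvd m")
    case True
    have "cmod (\<Sum>j<N. echar m (x - real j / real N)) \<le> of_nat N"
      using norm_sum[of "\<lambda>j. echar m (x - real j / real N)" "{..<N}"] by simp
    with True N show ?thesis by (simp add: norm_divide)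
  next
    case False
    have "z ^ N = cis (- (2 * pi * of_int m))"
      using N by (simp add: z_def echar_def Complex.DeMoivre)
    then have zN: "z ^ N = 1"
      using cis_multiple_2pi[of "of_int (- m)"] by simp
    \<comment> \<open>If \<open>z\<close> were 1, its angle would be a multiple of a full turn, so
      \<open>m / N\<close> would be an integer.\<close>
    have "z \<noteq> 1"
    proof
      assume "z = 1"
      then have "cos (2 * pi * (of_int (- m) / real N)) = 1"
        by (simp add: z_def echar_def complex_eq_iff)
      then obtain k :: int where "2 * pi * (of_int (- m) / real N) = of_int k * 2 * pi"
        using cos_one_2pi_int by blast
      then have "2 * pi * (of_int (- m) / real N) = 2 * pi * of_int k" by simp
      then have "of_int (- m) / real N = of_int k"
        unfolding mult_cancel_left by simp
      then have "of_int (- m) = real N * of_int k" using N by (simp add: field_simps)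
      then have "- m = int N * k" by (metis of_int_eq_iff of_int_mult of_int_of_nat_eq)
      then show False using False by (metis dvd_minus_iff dvd_triv_left)
    qed
    then show ?thesis using zN by (simp add: * geometric_sum)
  qed
qed

text \<open>All such \<open>b\<close> lie in one residue class modulo \<open>N\<close>, so each is
  determined by its quotient \<open>b div N\<close>, which is at most
  \<open>n div N\<close>.\<close>

lemma card_cong_less_le:
  assumes N: "N > 0"
  shows "card {b. b < n \<and> int N dvd int a - int b} \<le> n div N + 1"
proof -
  let ?B = "{b. b < n \<and> int N dvd int a - int b}"
  have "b mod N = a mod N" if "b \<in> ?B" for b
    using that by (simp flip: mod_eq_dvd_iff of_nat_mod)
  then have "inj_on (\<lambda>b. b div N) ?B"
    by (intro inj_onI) (metis div_mult_mod_eq)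
  moreover have "(\<lambda>b. b div N) ` ?B \<subseteq> {..n div N}"
    by (auto intro: div_le_mono)
  ultimately have "card ?B \<le> card {..n div N}"
    by (intro card_inj_on_le) auto
  then show ?thesis by simp
qed

text \<open>The squared modulus is a sum of characters of frequency \<open>a - b\<close>, and
  averaging kills those not divisible by \<open>N\<close>. For each of the \<open>n\<close> values
  of \<open>a\<close>, at most \<open>n / N + 1\<close> values of \<open>b\<close> survive.\<close>

lemma Estar_dker_le:
  assumes N: "N > 0"
  shows "Estar N (\<lambda>y. (cmod (dker n y))\<^sup>2) x \<le> real n * (real n / real N + 1)"
proof -
  have sq: "complex_of_real ((cmod (dker n y))\<^sup>2) = (\<Sum>a<n. \<Sum>b<n. echar (int a - int b) y)" for y
  proof -
    have "echar (int a) y * cnj (echar (int b) y) = echar (int a - int b) y" for a b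
      using echar_add[of "int a" "- int b" y] by (simp add: cnj_echar)
    then show ?thesis
      unfolding complex_norm_square dker_def cnj_sum sum_product by simp
  qed
  have "complex_of_real (Estar N (\<lambda>y. (cmod (dker n y))\<^sup>2) x)
      = (\<Sum>j<N. \<Sum>a<n. \<Sum>b<n. echar (int a - int b) (x - real j / real N)) / of_nat N"
    unfolding Estar_def by (simp add: sq flip: of_real_power)
  also have "\<dots> = (\<Sum>a<n. \<Sum>b<n. (\<Sum>j<N. echar (int a - int b) (x - real j / real N)) / of_nat N)"
    by (subst sum.swap, subst sum.swap[of _ "{..<n}" "{..<N}"])
       (simp add: sum_divide_distrib)
  finally have "cmod (complex_of_real (Estar N (\<lambda>y. (cmod (dker n y))\<^sup>2) x))
      \<le> (\<Sum>a<n. \<Sum>b<n. if int N dvd int a - int b then 1 else 0)"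
    using Estar_echar[OF N] by (auto intro!: sum_norm_le)
  also have "\<dots> = (\<Sum>a<n. real (card {b. b < n \<and> int N dvd int a - int b}))"
    by (intro sum.cong) (auto simp: sum.If_cases Int_def)
  also have "\<dots> \<le> (\<Sum>a<n. real n / real N + 1)"
  proof (intro sum_mono)
    fix a
    have "real (card {b. b < n \<and> int N dvd int a - int b}) \<le> real (n div N + 1)"
      using card_cong_less_le[OF N] of_nat_le_iff by blast
    also have "\<dots> \<le> real n / real N + 1"
      using of_nat_div_le_of_nat[of n N, where 'a = real] by simp
    finally show "real (card {b. b < n \<and> int N dvd int a - int b}) \<le> real n / real N + 1" .
  qed
  finally show ?thesis by simp
qed

lemma Estar_wker_le:
  assumes N: "N > 0" and d: "d > 0"
  shows "Estar N (wker d) x \<le> (3 + 5 * real d / real N) / 2"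
proof -
  have "Estar N (wker d) x = (Estar N (\<lambda>y. (cmod (dker d y))\<^sup>2) x
      + Estar N (\<lambda>y. (cmod (dker (2 * d) y))\<^sup>2) x) / (2 * real d)"
    by (simp add: Estar_def wker_def sum.distrib add_divide_distrib mult.commute
        flip: sum_divide_distrib)
  also have "\<dots> \<le> (real d * (real d / real N + 1)
      + real (2 * d) * (real (2 * d) / real N + 1)) / (2 * real d)"
    by (intro divide_right_mono add_mono Estar_dker_le N) simp
  \<comment> \<open>The two Fejer parts add up to \<open>3 * d + 5 * d\<^sup>2 / N\<close> before
    the division by \<open>2 * d\<close>.\<close>
  also have "\<dots> = (3 + 5 * real d / real N) / 2"
    using N d by (simp add: field_simps)
  finally show ?thesis .
qed

subsection \<open>Averages over translates\<close>

lemma continuous_on_L2_set [continuous_intros]: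
  assumes "\<And>i. i \<in> I \<Longrightarrow> continuous_on A (g i)"
  shows "continuous_on A (\<lambda>t. L2_set (\<lambda>i. g i t) I)"
  unfolding L2_set_def using assms by (intro continuous_intros) auto

lemma continuous_on_Estar [continuous_intros]:
  assumes "continuous_on UNIV g"
  shows "continuous_on A (Estar N g)"
proof -
  have "continuous_on A (\<lambda>x. g (x - real j / real N))" for j
    by (intro continuous_on_compose2[OF assms] continuous_intros) auto
  then show ?thesis
    unfolding Estar_def[abs_def] by (intro continuous_intros)
qed

text \<open>The reproducing formula for the vector of all \<open>f i\<close> is paired with the
  vector's own value at \<open>t\<close>. Cauchy-Schwarz in \<open>i\<close> then gives
  \<open>(S t)\<^sup>2\<close> at most \<open>S t\<close> times the right-hand side, with no loss
  depending on the size of \<open>I\<close>.\<close>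

lemma L2_set_H1_le:
  assumes fin: "finite I" and f: "\<And>i. i \<in> I \<Longrightarrow> f i \<in> H1 d" and d: "d > 0"
  defines "S \<equiv> \<lambda>t. L2_set (\<lambda>i. cmod (f i t)) I"
  shows "S t \<le> integral {0..1} (\<lambda>y. S y * wker d (t - y))"
proof -
  have contf: "continuous_on A (f i)" if "i \<in> I" for A i
    using continuous_on_H1 f that by blast
  have contS: "continuous_on A S" for A
    unfolding S_def by (intro continuous_intros contf)
  have int: "(\<lambda>y. S y * wker d (t - y)) integrable_on {0..1}"
    by (intro integrable_continuous_real continuous_intros contS)
  have S0: "S y \<ge> 0" for y by (simp add: S_def L2_set_nonneg)
  have w0: "wker d y \<ge> 0" for y by (simp add: wker_def)
  let ?h = "\<lambda>y. \<Sum>i\<in>I. cnj (f i t) * (f i y * vker d (t - y))"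
  have "(?h has_integral (\<Sum>i\<in>I. cnj (f i t) * f i t)) {0..1}"
    by (intro has_integral_sum fin has_integral_mult_right H1_reproducing f d)
  moreover have "(\<Sum>i\<in>I. cnj (f i t) * f i t) = of_real ((S t)\<^sup>2)"
    by (simp add: S_def L2_set_def sum_nonneg complex_norm_square mult.commute del: of_real_power)
  ultimately have h: "(?h has_integral of_real ((S t)\<^sup>2)) {0..1}" by simp
  have "cmod (?h y) \<le> S t * (S y * wker d (t - y))" for y
  proof -
    have "cmod (?h y) \<le> (\<Sum>i\<in>I. cmod (f i t) * cmod (f i y)) * cmod (vker d (t - y))"
      by (subst sum_distrib_right, intro sum_norm_le) (simp add: norm_mult)
    also have "\<dots> \<le> (S t * S y) * wker d (t - y)"
      using L2_set_mult_ineq[of "\<lambda>i. cmod (f i t)" "\<lambda>i. cmod (f i y)" I]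
      by (intro mult_mono norm_vker_le) (auto simp: S_def L2_set_nonneg)
    finally show ?thesis by (simp add: mult_ac)
  qed
  then have "cmod (integral {0..1} ?h) \<le> integral {0..1} (\<lambda>y. S t * (S y * wker d (t - y)))"
    by (intro integral_norm_bound_integral has_integral_integrable[OF h]
        integrable_continuous_real continuous_intros contS) auto
  then have "(S t)\<^sup>2 \<le> S t * integral {0..1} (\<lambda>y. S y * wker d (t - y))"
    using h by (simp add: integral_unique norm_power)
  moreover have "integral {0..1} (\<lambda>y. S y * wker d (t - y)) \<ge> 0"
    by (intro integral_nonneg int) (simp add: S0 w0)
  \<comment> \<open>A factor \<open>S t\<close> is cancelled; where it is zero, nonnegativity of the
    integral suffices.\<close>
  ultimately show ?thesis
    using S0[of t] by (cases "S t = 0") (auto simp: power2_eq_square)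
qed

text \<open>After averaging the previous bound, sum and integral are interchanged. The average then
  falls on the kernel, where it is bounded uniformly in \<open>x - y\<close> because
  \<open>d\<close> is at most \<open>\<beta> * N\<close>.\<close>

lemma Estar_L2_set_le:
  assumes fin: "finite I" and f: "\<And>i. i \<in> I \<Longrightarrow> f i \<in> H1 d" and d: "d > 0"
    and N: "N > 0" and dN: "real d \<le> \<beta> * real N"
  defines "S \<equiv> \<lambda>t. L2_set (\<lambda>i. cmod (f i t)) I"
  shows "Estar N S x \<le> (3 + 5 * \<beta>) / 2 * integral {0..1} S"
proof -
  have contf: "continuous_on A (f i)" if "i \<in> I" for A i
    using continuous_on_H1 f that by blast
  have contS: "continuous_on A S" for A
    unfolding S_def by (intro continuous_intros contf)
  have int: "(\<lambda>y. S y * wker d (x - real j / real N - y)) integrable_on {0..1}" for j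
    by (intro integrable_continuous_real continuous_intros contS)
  have "Estar N S x \<le> (1 / real N) * (\<Sum>j<N. integral {0..1} (\<lambda>y. S y * wker d (x - real j / real N - y)))"
    unfolding Estar_def S_def
    by (intro mult_left_mono sum_mono L2_set_H1_le fin f d) auto
  also have "\<dots> = integral {0..1} (\<lambda>y. (1 / real N) * (\<Sum>j<N. S y * wker d (x - real j / real N - y)))"
    using int by (simp add: integral_sum)
  also have "\<dots> \<le> integral {0..1} (\<lambda>y. (3 + 5 * \<beta>) / 2 * S y)"
  proof (intro integral_le integrable_continuous_real continuous_intros contS)
    fix y
    have "(1 / real N) * (\<Sum>j<N. S y * wker d (x - real j / real N - y))
        = Estar N (wker d) (x - y) * S y"
      by (simp add: Estar_def sum_distrib_left sum_distrib_right sum_divide_distrib algebra_simps)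
    also have "\<dots> \<le> (3 + 5 * \<beta>) / 2 * S y"
    proof (intro mult_right_mono order_trans[OF Estar_wker_le[OF N d]])
      have "real d / real N \<le> \<beta>" using dN N by (simp add: field_simps)
      then show "(3 + 5 * real d / real N) / 2 \<le> (3 + 5 * \<beta>) / 2" by simp
    qed (simp add: S_def L2_set_nonneg)
    finally show "(1 / real N) * (\<Sum>j<N. S y * wker d (x - real j / real N - y))
        \<le> (3 + 5 * \<beta>) / 2 * S y" .
  qed
  also have "\<dots> = (3 + 5 * \<beta>) / 2 * integral {0..1} S" by simp
  finally show ?thesis .
qed

section \<open>Periodicity and the transfer of averages under the integral\<close>

lemma integral_periodic_shift:
  fixes g :: "real \<Rightarrow> real"
  assumes cont: "continuous_on UNIV g" and per: "\<And>t. g (t + 1) = g t"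
    and a: "0 \<le> a" "a \<le> 1"
  shows "integral {0..1} (\<lambda>x. g (x - a)) = integral {0..1} g"
proof -
  have c: "continuous_on A g" for A using cont continuous_on_subset by blast
  have i: "g integrable_on {p..q}" for p q
    by (intro integrable_continuous_real c)
  have shift: "integral {p..q} (\<lambda>x. g (x + r)) = integral {p + r..q + r} g" for p q r
    using integral_shift[of p r q g] c by (simp add: o_def)
  have "integral {0..1} (\<lambda>x. g (x - a)) = integral {- a..1 - a} g"
    using shift[of 0 1 "- a"] by simp
  also have "\<dots> = integral {- a..0} g + integral {0..1 - a} g"
    using a by (intro Henstock_Kurzweil_Integration.integral_combine[symmetric] i) auto
  also have "integral {- a..0} g = integral {1 - a..1} g"
    using shift[of "- a" 0 1] per by simp
  also have "integral {1 - a..1} g + integral {0..1 - a} g = integral {0..1} g"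
    using Henstock_Kurzweil_Integration.integral_combine[of 0 "1 - a" 1 g] a i by simp
  finally show ?thesis .
qed

text \<open>Shifting by \<open>1 / N\<close> permutes the \<open>N\<close> translates cyclically:
  the one pushed out at one end returns at the other by 1-periodicity.\<close>

lemma Estar_periodic:
  assumes "\<And>t. g (t + 1) = g t" and N: "N > 0"
  shows "Estar N g (x + 1 / real N) = Estar N g x"
proof -
  obtain n where n: "N = Suc n" using N gr0_implies_Suc by blast
  have "(\<Sum>j<N. g (x + 1 / real N - real j / real N))
      = g (x + 1 / real N) + (\<Sum>j<n. g (x + 1 / real N - real (Suc j) / real N))"
    unfolding n by (subst sum.lessThan_Suc_shift) simp
  also have "(\<Sum>j<n. g (x + 1 / real N - real (Suc j) / real N)) = (\<Sum>j<n. g (x - real j / real N))"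
    by (intro sum.cong refl arg_cong[where f = g]) (simp add: diff_divide_distrib add_divide_distrib)
  also have "g (x + 1 / real N) = g (x - real n / real N)"
  proof -
    have "x + 1 / real N = x - real n / real N + 1" unfolding n by (simp add: field_simps)
    then show ?thesis using assms(1) by metis
  qed
  also have "g (x - real n / real N) + (\<Sum>j<n. g (x - real j / real N)) = (\<Sum>j<N. g (x - real j / real N))"
    unfolding n by simp
  finally show ?thesis by (simp add: Estar_def)
qed

text \<open>Since \<open>v\<close> is unchanged by each shift, it can be translated along with
  \<open>g\<close>; every summand then has the same integral over the full period.\<close>

lemma integral_Estar_mult:
  fixes g v :: "real \<Rightarrow> real"
  assumes g: "continuous_on UNIV g" "\<And>t. g (t + 1) = g t"
    and v: "continuous_on UNIV v" "\<And>t. v (t + 1 / real N) = v t" and N: "N > 0"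
  shows "integral {0..1} (\<lambda>t. Estar N g t * v t) = integral {0..1} (\<lambda>t. g t * v t)"
proof -
  have vj: "v (t + real j / real N) = v t" for t j
  proof (induction j)
    case (Suc j)
    then show ?case using v(2)[of "t + real j / real N"] by (simp add: add_divide_distrib add_ac)
  qed simp
  have v1: "v (t + 1) = v t" for t using vj[of t N] N by simp
  have c: "continuous_on UNIV (\<lambda>t. g t * v t)" using g v by (intro continuous_intros)
  have i: "(\<lambda>t. g (t - a) * v (t - a)) integrable_on {0..1}" for a
    by (intro integrable_continuous_real continuous_on_compose2[OF c, of _ "\<lambda>t. t - a"]
        continuous_intros) auto
  have vj': "v (t - real j / real N) = v t" for t j
    using vj[of "t - real j / real N" j] by simp
  have "integral {0..1} (\<lambda>t. Estar N g t * v t)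
      = integral {0..1} (\<lambda>t. (1 / real N) * (\<Sum>j<N. g (t - real j / real N) * v (t - real j / real N)))"
    by (simp add: Estar_def sum_distrib_right vj')
  also have "\<dots> = (1 / real N) * (\<Sum>j<N. integral {0..1} (\<lambda>t. g (t - real j / real N) * v (t - real j / real N)))"
    using i by (simp add: integral_sum)
  also have "\<dots> = (1 / real N) * (\<Sum>j<N. integral {0..1} (\<lambda>t. g t * v t))"
    using integral_periodic_shift[OF c, simplified g(2) v1] by simp
  also have "\<dots> = integral {0..1} (\<lambda>t. g t * v t)" using N by simp
  finally show ?thesis .
qed

subsection \<open>Square function estimates\<close>

text \<open>With \<open>y k\<close> the truncated products and \<open>T\<close> their sum,
  \<open>(x k)\<^sup>2 \<le> (l + T) * y k\<close>: for \<open>x k \<le> l\<close> the term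
  \<open>l * y k\<close> equals the square, and otherwise \<open>x k = y k \<le> T\<close>. The
  right-hand side is a sum of functions of single entries, so integrating it over a product space
  involves only the marginals.\<close>

lemma L2_set_le_truncated_sum:
  fixes x :: "'a \<Rightarrow> real"
  assumes fin: "finite A" and x: "\<And>k. k \<in> A \<Longrightarrow> x k \<ge> 0" and l: "l > 0"
  shows "L2_set x A \<le> (\<Sum>k\<in>A. x k * min 1 (x k / l)) + l"
proof -
  define y where "y k = x k * min 1 (x k / l)" for k
  define T where "T = (\<Sum>k\<in>A. y k)"
  have y: "y k \<ge> 0" if "k \<in> A" for k using x[OF that] l by (simp add: y_def)
  have T: "T \<ge> 0" unfolding T_def by (intro sum_nonneg y)
  have "(x k)\<^sup>2 \<le> (l + T) * y k" if k: "k \<in> A" for k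
  proof (cases "x k \<le> l")
    case True
    then have "l * y k = (x k)\<^sup>2" using l by (simp add: y_def power2_eq_square)
    moreover have "T * y k \<ge> 0" using T y[OF k] by simp
    ultimately show ?thesis by (simp add: algebra_simps)
  next
    case False
    then have "y k = x k" using l by (simp add: y_def)
    moreover have "y k \<le> l + T" using member_le_sum[of k A y] k y fin l by (simp add: T_def)
    ultimately show ?thesis using x[OF k] by (simp add: power2_eq_square mult_right_mono)
  qed
  then have "(\<Sum>k\<in>A. (x k)\<^sup>2) \<le> (\<Sum>k\<in>A. (l + T) * y k)" by (rule sum_mono)
  also have "\<dots> = (l + T) * T" by (simp add: T_def sum_distrib_left)
  also have "\<dots> \<le> (T + l)\<^sup>2" using l T by (simp add: power2_eq_square algebra_simps)
  finally have "sqrt (\<Sum>k\<in>A. (x k)\<^sup>2) \<le> T + l"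
    using l T by (simp add: real_le_lsqrt)
  then show ?thesis by (simp add: L2_set_def T_def y_def)
qed

lemma sum_shifted_diff_le:
  fixes S :: "nat \<Rightarrow> real"
  assumes S: "mono S" "S 0 = 0"
  shows "(\<Sum>k=1..n. S k - S (k - s)) \<le> real s * S n"
proof (induction s)
  case (Suc s)
  \<comment> \<open>The sum telescopes; truncated subtraction makes the terms with
    \<open>k \<le> s\<close> vanish, and the lower end contributes \<open>S 0 = 0\<close>.\<close>
  have "(\<Sum>k=1..n. S (k - s) - S (k - Suc s)) = S (n - s)"
    using S(2) by (induction n) auto
  also have "\<dots> \<le> S n" using S(1) by (simp add: monoD)
  finally have "(\<Sum>k=1..n. S (k - s) - S (k - Suc s)) \<le> S n" .
  moreover have "(\<Sum>k=1..n. S k - S (k - Suc s))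
      = (\<Sum>k=1..n. S k - S (k - s)) + (\<Sum>k=1..n. S (k - s) - S (k - Suc s))"
    by (simp flip: sum.distrib)
  ultimately show ?case using Suc.IH by (simp add: algebra_simps)
qed simp

text \<open>From \<open>(x k)\<^sup>2 = (S k)\<^sup>2 - (S (k - 1))\<^sup>2 \<le> 2 * S k * (S k - S
  (k - 1))\<close>, the inequality of the means splits \<open>x k * u k\<close> into a telescoping
  increment and a term in \<open>S k * (u k)\<^sup>2\<close>. The weight \<open>a\<close> balancing
  the two stays free.\<close>

lemma sum_mult_le_square_function:
  fixes x u :: "nat \<Rightarrow> real"
  assumes u: "\<And>k. 0 \<le> u k" "\<And>k. u k \<le> 1" and a: "a > 0"
  defines "S \<equiv> \<lambda>k. L2_set x {1..k}"
  shows "(\<Sum>k=1..n. x k * u k)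
      \<le> a * S n + (real s * S n + (\<Sum>k=1..n. S (k - s) * (u k)\<^sup>2)) / (2 * a)"
proof -
  have S0: "S 0 = 0" by (simp add: S_def)
  have Snn: "S k \<ge> 0" for k by (simp add: S_def L2_set_nonneg)
  have mono: "mono S"
    unfolding S_def L2_set_def by (intro monoI real_sqrt_le_mono sum_mono2) auto
  have step: "x k * u k \<le> a * (S k - S (k - 1)) + S k * (u k)\<^sup>2 / (2 * a)" if "k \<in> {1..n}" for k
  proof (rule power2_le_imp_le)
    have le: "S (k - 1) \<le> S k" using mono by (simp add: monoD)
    from that obtain m where k: "k = Suc m" by (cases k) auto
    have "(x k)\<^sup>2 = (S k)\<^sup>2 - (S (k - 1))\<^sup>2"
      by (simp add: k S_def L2_set_def sum_nonneg add_nonneg_nonneg)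
    also have "\<dots> = (S k + S (k - 1)) * (S k - S (k - 1))"
      by (simp add: power2_eq_square algebra_simps)
    also have "\<dots> \<le> (2 * S k) * (S k - S (k - 1))"
      using le by (intro mult_right_mono) auto
    finally have "(x k)\<^sup>2 * (u k)\<^sup>2 \<le> (2 * S k) * (S k - S (k - 1)) * (u k)\<^sup>2"
      by (rule mult_right_mono) simp
    also have "\<dots> = 2 * (2 * (a * (S k - S (k - 1))) * (S k * (u k)\<^sup>2 / (2 * a)))"
      using a by (simp add: field_simps)
    also have "\<dots> \<le> (a * (S k - S (k - 1)) + S k * (u k)\<^sup>2 / (2 * a))\<^sup>2"
      using sum_squares_bound[of "a * (S k - S (k - 1))" "S k * (u k)\<^sup>2 / (2 * a)"]
      by (simp add: power2_sum)
    finally show "(x k * u k)\<^sup>2 \<le> (a * (S k - S (k - 1)) + S k * (u k)\<^sup>2 / (2 * a))\<^sup>2"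
      by (simp add: power_mult_distrib)
    show "0 \<le> a * (S k - S (k - 1)) + S k * (u k)\<^sup>2 / (2 * a)"
      using le a Snn by simp
  qed
  \<comment> \<open>Because \<open>(u k)\<^sup>2 \<le> 1\<close>, the delay by \<open>s\<close>
    indices costs only the difference of the two values of \<open>S\<close>, and these differences
    sum to at most \<open>s * S n\<close>.\<close>
  have "S k * (u k)\<^sup>2 \<le> S (k - s) * (u k)\<^sup>2 + (S k - S (k - s))" for k
  proof -
    have "(S k - S (k - s)) * (u k)\<^sup>2 \<le> (S k - S (k - s)) * 1"
      using mono u by (intro mult_left_mono) (auto simp: monoD power_le_one)
    then show ?thesis by (simp add: algebra_simps)
  qed
  then have "(\<Sum>k=1..n. S k * (u k)\<^sup>2)
      \<le> (\<Sum>k=1..n. S (k - s) * (u k)\<^sup>2 + (S k - S (k - s)))"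
    by (intro sum_mono)
  also have "\<dots> \<le> (\<Sum>k=1..n. S (k - s) * (u k)\<^sup>2) + real s * S n"
    using sum_shifted_diff_le[OF mono S0, where n = n and s = s] by (simp add: sum.distrib)
  finally have 2: "(\<Sum>k=1..n. S k * (u k)\<^sup>2) / (2 * a)
      \<le> (real s * S n + (\<Sum>k=1..n. S (k - s) * (u k)\<^sup>2)) / (2 * a)"
    using a by (intro divide_right_mono) auto
  have "(\<Sum>k=1..n. S k - S (k - 1)) = S n" using S0 by (induction n) auto
  then have "(\<Sum>k=1..n. a * (S k - S (k - 1)) + S k * (u k)\<^sup>2 / (2 * a))
      = a * S n + (\<Sum>k=1..n. S k * (u k)\<^sup>2) / (2 * a)"
    by (simp add: sum.distrib sum_divide_distrib flip: sum_distrib_left)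
  moreover have "(\<Sum>k=1..n. x k * u k)
      \<le> (\<Sum>k=1..n. a * (S k - S (k - 1)) + S k * (u k)\<^sup>2 / (2 * a))"
    by (rule sum_mono) (rule step)
  ultimately show ?thesis using 2 by linarith
qed

lemma sum_integral_Estar_truncated_le:
  fixes f :: "nat \<Rightarrow> real \<Rightarrow> complex" and d N :: "nat \<Rightarrow> nat"
  assumes f: "\<And>k. k \<ge> 1 \<Longrightarrow> f k \<in> H1 (d k)"
    and d: "\<And>k. k \<ge> 1 \<Longrightarrow> d k > 0" and N: "\<And>k. k \<ge> 1 \<Longrightarrow> N k > 0"
    and mono: "\<And>j k. 1 \<le> j \<Longrightarrow> j \<le> k \<Longrightarrow> d j \<le> d k"
    and dN: "\<And>k. k \<ge> 1 \<Longrightarrow> real (d k) \<le> \<beta> * real (N (k + s))"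
    and \<beta>: "\<beta> > 0" and l: "l > 0"
    and Sl: "integral {0..1} (\<lambda>t. L2_set (\<lambda>k. cmod (f k t)) {1..n}) \<le> l"
  defines "X \<equiv> \<lambda>k. Estar (N k) (\<lambda>t. cmod (f k t))"
  shows "(\<Sum>k=1..n. integral {0..1} (\<lambda>t. X k t * min 1 (X k t / l))) \<le> l * (3 + 5 * \<beta> + real s)"
proof -
  define C where "C = (3 + 5 * \<beta>) / 2"
  define u where "u k t = min 1 (X k t / l)" for k t
  define S where "S k t = L2_set (\<lambda>j. cmod (f j t)) {1..k}" for k t
  define A where "A = (\<Sum>k=1..n. integral {0..1} (\<lambda>t. (u k t)\<^sup>2))"
  define B where "B = (\<Sum>k=1..n. integral {0..1} (\<lambda>t. X k t * u k t))"
  have C1: "C > 1" using \<beta> by (simp add: C_def)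
  have contf: "continuous_on T (f k)" if "k \<ge> 1" for T k
    using continuous_on_H1 f that by blast
  have contX: "continuous_on T (X k)" if "k \<ge> 1" for T k
    unfolding X_def by (intro continuous_intros contf that)
  have contu: "continuous_on T (u k)" if "k \<ge> 1" for T k
    unfolding u_def using l by (intro continuous_intros contX that) auto
  have contS: "continuous_on T (S k)" for T k
    unfolding S_def by (intro continuous_intros contf) auto
  have X0: "X k t \<ge> 0" for k t
    unfolding X_def Estar_def by (intro mult_nonneg_nonneg sum_nonneg) auto
  have u01: "0 \<le> u k t" "u k t \<le> 1" for k t using X0 l by (auto simp: u_def)
  \<comment> \<open>This comparison is what later allows the sum \<open>A\<close> to be absorbed
    into \<open>B\<close>.\<close>
  have uX: "l * (u k t)\<^sup>2 \<le> X k t * u k t" for k t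
  proof -
    have "l * u k t \<le> X k t" using l by (auto simp: u_def min_def field_simps)
    then show ?thesis using u01[of k t] by (simp add: power2_eq_square mult_right_mono flip: mult.assoc)
  qed
  have uper: "u k (t + 1 / real (N k)) = u k t" if "k \<ge> 1" for k t
    unfolding u_def X_def using Estar_periodic N[OF that] H1_plus_one[OF f[OF that]] by simp
  have intS0: "integral {0..1} (S k) \<ge> 0" for k
    by (intro integral_nonneg integrable_continuous_real contS) (simp add: S_def L2_set_nonneg)
  have S_mono: "integral {0..1} (S j) \<le> l" if "j \<le> n" for j
  proof -
    have "S j t \<le> S n t" for t unfolding S_def L2_set_def
      using that by (intro real_sqrt_le_mono sum_mono2) auto
    then have "integral {0..1} (S j) \<le> integral {0..1} (S n)"
      by (intro integral_le integrable_continuous_real contS) auto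
    then show ?thesis using Sl by (simp add: S_def[abs_def])
  qed
  \<comment> \<open>The period \<open>1 / N k\<close> of \<open>u k\<close> lets
    \<open>S (k - s)\<close> be replaced by its average. With \<open>m = k - s\<close>, the
    polynomials in \<open>S m\<close> have degree at most
    \<open>d m \<le> \<beta> * N (m + s) = \<beta> * N k\<close>, so this average is at most
    \<open>C * l\<close> everywhere. For \<open>k \<le> s\<close> the index is 0 and
    \<open>S\<close> is an empty sum.\<close>
  have decoupled: "integral {0..1} (\<lambda>t. S (k - s) t * (u k t)\<^sup>2)
      \<le> C * l * integral {0..1} (\<lambda>t. (u k t)\<^sup>2)" if k: "k \<in> {1..n}" for k
  proof (cases "k \<le> s")
    case True
    then have "S (k - s) t = 0" for t by (simp add: S_def)
    moreover have "integral {0..1} (\<lambda>t. (u k t)\<^sup>2) \<ge> 0"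
      using k by (intro integral_nonneg integrable_continuous_real continuous_intros contu) auto
    ultimately show ?thesis using C1 l by simp
  next
    case False
    define m where "m = k - s"
    have m: "m \<ge> 1" "k = m + s" "m \<le> n" using False k by (auto simp: m_def)
    have Sper: "S m (t + 1) = S m t" for t
      unfolding S_def using H1_plus_one[OF f] by (intro L2_set_cong) auto
    have Ele: "Estar (N k) (S m) t \<le> C * l" for t
    proof -
      have "Estar (N k) (S m) t \<le> C * integral {0..1} (S m)"
        unfolding S_def C_def
      proof (rule Estar_L2_set_le)
        show "f i \<in> H1 (d m)" if "i \<in> {1..m}" for i
          using that f[of i] H1_mono mono[of i m] by auto
      qed (use d N dN m in auto)
      also have "\<dots> \<le> C * l" using S_mono[OF m(3)] C1 by simp
      finally show ?thesis .
    qed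
    have "integral {0..1} (\<lambda>t. S m t * (u k t)\<^sup>2)
        = integral {0..1} (\<lambda>t. Estar (N k) (S m) t * (u k t)\<^sup>2)"
      using k N uper Sper
      by (intro integral_Estar_mult[symmetric] continuous_intros contS contu) auto
    also have "\<dots> \<le> integral {0..1} (\<lambda>t. C * l * (u k t)\<^sup>2)"
      using Ele k
      by (intro integral_le integrable_continuous_real continuous_intros contS contu mult_right_mono) auto
    finally show ?thesis by (simp add: m_def)
  qed
  have "B = (\<Sum>k=1..n. integral {0..1} (\<lambda>t. cmod (f k t) * u k t))"
    unfolding B_def
  proof (intro sum.cong refl)
    fix k assume "k \<in> {1..n}"
    then show "integral {0..1} (\<lambda>t. X k t * u k t) = integral {0..1} (\<lambda>t. cmod (f k t) * u k t)"
      unfolding X_def using N uper H1_plus_one[OF f]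
      by (intro integral_Estar_mult continuous_intros contf contu) auto
  qed
  also have "\<dots> = integral {0..1} (\<lambda>t. \<Sum>k=1..n. cmod (f k t) * u k t)"
    by (intro integral_sum[symmetric] integrable_continuous_real continuous_intros contf contu) auto
  \<comment> \<open>Choosing \<open>a = C\<close> makes the decoupled part
    \<open>C * l * A / (2 * C) = l * A / 2\<close>, a coefficient small enough for
    absorption.\<close>
  also have "\<dots> \<le> integral {0..1} (\<lambda>t. C * S n t
      + (real s * S n t + (\<Sum>k=1..n. S (k - s) t * (u k t)\<^sup>2)) / (2 * C))"
    using sum_mult_le_square_function[where a = C and s = s and n = n] u01 C1
    by (intro integral_le integrable_continuous_real continuous_intros contf contu contS)
       (auto simp: S_def)
  also have "\<dots> = C * integral {0..1} (S n) + (real s * integral {0..1} (S n)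
      + (\<Sum>k=1..n. integral {0..1} (\<lambda>t. S (k - s) t * (u k t)\<^sup>2))) / (2 * C)"
  proof (rule integral_unique)
    show "((\<lambda>t. C * S n t
        + (real s * S n t + (\<Sum>k=1..n. S (k - s) t * (u k t)\<^sup>2)) / (2 * C)) has_integral
        (C * integral {0..1} (S n) + (real s * integral {0..1} (S n)
        + (\<Sum>k=1..n. integral {0..1} (\<lambda>t. S (k - s) t * (u k t)\<^sup>2))) / (2 * C))) {0..1}"
      by (intro has_integral_add has_integral_mult_right has_integral_divide has_integral_sum
          integrable_integral integrable_continuous_real continuous_intros contS contu) auto
  qed
  also have "\<dots> \<le> C * l + (real s * l + C * l * A) / (2 * C)"
    unfolding A_def sum_distrib_left using C1 S_mono[of n]
    by (intro add_mono mult_left_mono divide_right_mono sum_mono decoupled) auto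
  also have "\<dots> \<le> l * (C + real s / 2 + A / 2)"
  proof -
    have "real s * l / (2 * C) \<le> real s * l / 2" using C1 l by (intro divide_left_mono) auto
    then show ?thesis using C1 by (simp add: field_simps)
  qed
  finally have B: "B \<le> l * (C + real s / 2 + A / 2)" .
  \<comment> \<open>Absorption: \<open>l * A \<le> B\<close> and the bound on \<open>B\<close> give
    \<open>A \<le> 2 * C + s\<close>, and inserting this into the same bound removes
    \<open>A\<close>.\<close>
  have "l * A = (\<Sum>k=1..n. integral {0..1} (\<lambda>t. l * (u k t)\<^sup>2))"
    by (simp add: A_def sum_distrib_left)
  also have "\<dots> \<le> B" unfolding B_def using uX
    by (intro sum_mono integral_le integrable_continuous_real continuous_intros contX contu) auto
  finally have "l * A \<le> l * (C + real s / 2 + A / 2)" using B by simp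
  then have "A \<le> 2 * C + real s" using l by simp
  then have "l * (C + real s / 2 + A / 2) \<le> l * (2 * C + real s)"
    using l by (intro mult_left_mono) auto
  with B have "B \<le> l * (2 * C + real s)" by simp
  moreover have "2 * C = 3 + 5 * \<beta>" by (simp add: C_def)
  ultimately show ?thesis by (simp add: B_def u_def)
qed

subsection \<open>Transfer to the product space\<close>

lemma prob_space_torus: "prob_space torus_measure"
  by (auto intro!: prob_spaceI
      simp: torus_measure_def space_restrict_space emeasure_restrict_space)

lemma borel_measurable_torus:
  fixes g :: "real \<Rightarrow> real"
  shows "continuous_on UNIV g \<Longrightarrow> g \<in> borel_measurable torus_measure"
  unfolding torus_measure_def
  by (intro measurable_restrict_space1) (simp add: borel_measurable_continuous_onI)

lemma nn_integral_torus:
  fixes g :: "real \<Rightarrow> real"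
  assumes g: "continuous_on UNIV g" "\<And>t. g t \<ge> 0"
  shows "(\<integral>\<^sup>+t. ennreal (g t) \<partial>torus_measure) = ennreal (integral {0..1} g)"
proof -
  have "g integrable_on {0..1}"
    using g(1) continuous_on_subset by (intro integrable_continuous_real) blast
  then have "(g has_integral integral {0..1} g) {0..1}" by (rule integrable_integral)
  \<comment> \<open>The half-open and the closed interval differ only in the point 1.\<close>
  moreover have "negligible {x \<in> {0..<1} - {0..1}. g x \<noteq> 0}" "negligible {x \<in> {0..1} - {0..<1}. g x \<noteq> 0}"
    by (auto intro: negligible_subset[of "{1}"])
  ultimately have "(g has_integral integral {0..1} g) {0..<1}"
    using has_integral_spike_set_eq by blast
  from nn_integral_has_integral_lebesgue'[OF g(2) this] show ?thesis
    by (simp add: torus_measure_def nn_integral_restrict_space)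
qed

text \<open>The projection to one coordinate pushes the product measure forward to its
  factor.\<close>

lemma nn_integral_PiM_torus_component:
  fixes g :: "real \<Rightarrow> real"
  assumes g: "continuous_on UNIV g" "\<And>t. g t \<ge> 0"
  shows "(\<integral>\<^sup>+\<omega>. ennreal (g (\<omega> k)) \<partial>PiM (UNIV :: nat set) (\<lambda>_. torus_measure))
    = ennreal (integral {0..1} g)"
proof -
  have "(\<integral>\<^sup>+t. ennreal (g t) \<partial>torus_measure)
      = (\<integral>\<^sup>+t. ennreal (g t) \<partial>distr (PiM (UNIV :: nat set) (\<lambda>_. torus_measure)) torus_measure (\<lambda>\<omega>. \<omega> k))"
    using distr_PiM_component[of "UNIV :: nat set" "\<lambda>_. torus_measure" k] prob_space_torus by simp
  also have "\<dots> = (\<integral>\<^sup>+\<omega>. ennreal (g (\<omega> k)) \<partial>PiM (UNIV :: nat set) (\<lambda>_. torus_measure))"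
    using borel_measurable_torus[OF g(1)] by (intro nn_integral_distr) auto
  finally show ?thesis using nn_integral_torus[OF g] by simp
qed

text \<open>Monotone convergence reduces the infinite sequence to its finite sections; continuity
  supplies measurability.\<close>

lemma ind_norm_eq_SUP:
  assumes g: "\<And>k. k \<ge> 1 \<Longrightarrow> continuous_on UNIV (g k)"
  shows "ind_norm g = (SUP n. \<integral>\<^sup>+\<omega>. ennreal (L2_set (\<lambda>k. g k (\<omega> k)) {1..n})
    \<partial>PiM (UNIV :: nat set) (\<lambda>_. torus_measure))"
proof -
  let ?M = "PiM (UNIV :: nat set) (\<lambda>_. torus_measure)"
  have [measurable]: "(\<lambda>\<omega>. g k (\<omega> k)) \<in> borel_measurable ?M" if "k \<ge> 1" for k
    by (rule measurable_compose[OF _ borel_measurable_torus[OF g[OF that]]]) simp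
  have "(\<lambda>\<omega>. ennreal (L2_set (\<lambda>k. g k (\<omega> k)) {1..n})) \<in> borel_measurable ?M" for n
    unfolding L2_set_def
    by (intro measurable_compose[OF _ measurable_ennreal]
        measurable_compose[OF _ borel_measurable_sqrt]
        borel_measurable_sum borel_measurable_power) auto
  moreover have "incseq (\<lambda>n \<omega>. ennreal (L2_set (\<lambda>k. g k (\<omega> k)) {1..n}))"
    unfolding L2_set_def incseq_def le_fun_def
    by (intro allI impI ennreal_leI real_sqrt_le_mono sum_mono2) auto
  ultimately show ?thesis
    unfolding ind_norm_def l2norm_def L2_set_def
    by (subst nn_integral_monotone_convergence_SUP[symmetric]) auto
qed

text \<open>Placing \<open>c\<close> before \<open>d\<close>, \<open>N\<close> and \<open>f\<close>
  expresses its uniformity, with \<open>\<beta>\<close> an upper bound for the ratios of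
  \<open>d k\<close> to \<open>N (k + s)\<close>.\<close>

theorem theorem2p11:
  fixes s :: nat and \<alpha> \<beta> :: real
  assumes "\<alpha> > 0" and "\<beta> > 0"
  shows "\<exists>c>0. \<forall>(d :: nat \<Rightarrow> nat) (N :: nat \<Rightarrow> nat).
           (\<forall>k\<ge>1. d k > 0 \<and> N k > 0) \<and>
           (\<forall>k\<ge>1. real (d (k + 1)) \<ge> (1 + \<alpha>) * real (d k)) \<and>
           (\<forall>k\<ge>1. real (d k) \<le> \<beta> * real (N (k + s))) \<longrightarrow>
           (\<forall>f :: nat \<Rightarrow> real \<Rightarrow> complex. (\<forall>k\<ge>1. f k \<in> H1 (d k)) \<longrightarrow>
              ind_norm (\<lambda>k. Estar (N k) (\<lambda>t. cmod (f k t)))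
                \<le> ennreal c * L1l2_norm (\<lambda>k t. cmod (f k t)))"
proof -
  define C where "C = 3 + 5 * \<beta> + real s"
  have C: "C > 0" using assms by (simp add: C_def)
  have "ind_norm (\<lambda>k. Estar (N k) (\<lambda>t. cmod (f k t)))
      \<le> ennreal (C + 1) * L1l2_norm (\<lambda>k t. cmod (f k t))"
    if pos: "\<And>k. k \<ge> 1 \<Longrightarrow> d k > 0" "\<And>k. k \<ge> 1 \<Longrightarrow> N k > 0"
      and lac: "\<And>k. k \<ge> 1 \<Longrightarrow> real (d (k + 1)) \<ge> (1 + \<alpha>) * real (d k)"
      and dN: "\<And>k. k \<ge> 1 \<Longrightarrow> real (d k) \<le> \<beta> * real (N (k + s))"
      and f: "\<And>k. k \<ge> 1 \<Longrightarrow> f k \<in> H1 (d k)"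
    for d N :: "nat \<Rightarrow> nat" and f :: "nat \<Rightarrow> real \<Rightarrow> complex"
  proof -
    define X where "X k = Estar (N k) (\<lambda>t. cmod (f k t))" for k
    define L where "L = L1l2_norm (\<lambda>k t. cmod (f k t))"
    let ?M = "PiM (UNIV :: nat set) (\<lambda>_. torus_measure)"
    \<comment> \<open>Monotone degrees put \<open>f 1\<close> to \<open>f m\<close> into the common
      space \<open>H1 (d m)\<close>.\<close>
    have mono: "d j \<le> d k" if "1 \<le> j" "j \<le> k" for j k
      using that(2,1)
    proof (induction rule: dec_induct)
      case (step k)
      have "1 * real (d k) \<le> (1 + \<alpha>) * real (d k)" using assms by (intro mult_right_mono) auto
      also have "\<dots> \<le> real (d (k + 1))" using lac[of k] step by simp
      finally show ?case using step by simp
    qed simp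
    have contf: "continuous_on A (f k)" if "k \<ge> 1" for A k
      using continuous_on_H1 f that by blast
    have contX: "continuous_on A (X k)" if "k \<ge> 1" for A k
      unfolding X_def by (intro continuous_intros contf that)
    have X0: "X k t \<ge> 0" for k t
      unfolding X_def Estar_def by (intro mult_nonneg_nonneg sum_nonneg) auto
    have SL: "ennreal (integral {0..1} (\<lambda>t. L2_set (\<lambda>k. cmod (f k t)) {1..n})) \<le> L" for n
    proof -
      have "ennreal (integral {0..1} (\<lambda>t. L2_set (\<lambda>k. cmod (f k t)) {1..n}))
          = (\<integral>\<^sup>+t. ennreal (L2_set (\<lambda>k. cmod (f k t)) {1..n}) \<partial>torus_measure)"
        by (intro nn_integral_torus[symmetric] continuous_intros contf L2_set_nonneg) auto
      also have "\<dots> \<le> L"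
        unfolding L_def L1l2_norm_def l2norm_def L2_set_def
        by (intro nn_integral_mono SUP_upper2[OF UNIV_I order_refl])
      finally show ?thesis .
    qed
    \<comment> \<open>The truncation level must be a positive real, whereas \<open>L\<close> may be
      zero or infinite, so the estimate is first proved for any \<open>l > 0\<close> above
      \<open>L\<close>. In the factor \<open>C + 1\<close>, \<open>C\<close> comes from the
      truncated sum and 1 from the additive \<open>l\<close>.\<close>
    have bound: "(\<integral>\<^sup>+\<omega>. ennreal (L2_set (\<lambda>k. X k (\<omega> k)) {1..n}) \<partial>?M) \<le> ennreal ((C + 1) * l)"
      if l: "l > 0" "L \<le> ennreal l" for n l
    proof -
      interpret prob_space ?M by (intro prob_space_PiM prob_space_torus)
      define Y where "Y k t = X k t * min 1 (X k t / l)" for k t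
      have contY: "continuous_on A (Y k)" if "k \<ge> 1" for A k
        unfolding Y_def using l by (intro continuous_intros contX that) auto
      have Y0: "Y k t \<ge> 0" for k t using X0 l by (simp add: Y_def)
      have intY: "integral {0..1} (Y k) \<ge> 0" if "k \<ge> 1" for k
        by (intro integral_nonneg integrable_continuous_real contY that) (simp add: Y0)
      have measY: "(\<lambda>\<omega>. ennreal (Y k (\<omega> k))) \<in> borel_measurable ?M" if "k \<in> {1..n}" for k
      proof -
        have "Y k \<in> borel_measurable torus_measure"
          using that by (intro borel_measurable_torus contY) auto
        then show ?thesis
          by (intro measurable_compose[OF _ measurable_ennreal]
              measurable_compose[OF measurable_component_singleton]) auto
      qed
      have "integral {0..1} (\<lambda>t. L2_set (\<lambda>k. cmod (f k t)) {1..n}) \<le> l"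
        using order_trans[OF SL l(2)] l(1) by (simp add: ennreal_le_iff)
      then have sum: "(\<Sum>k=1..n. integral {0..1} (Y k)) \<le> l * C"
        unfolding C_def Y_def[abs_def] X_def
        using f pos mono dN assms(2) l(1)
        by (intro sum_integral_Estar_truncated_le[where d = d and N = N and f = f]) auto
      have "(\<integral>\<^sup>+\<omega>. ennreal (L2_set (\<lambda>k. X k (\<omega> k)) {1..n}) \<partial>?M)
          \<le> (\<integral>\<^sup>+\<omega>. (\<Sum>k=1..n. ennreal (Y k (\<omega> k))) + ennreal l \<partial>?M)"
      proof (intro nn_integral_mono)
        fix \<omega> :: "nat \<Rightarrow> real"
        have "ennreal (L2_set (\<lambda>k. X k (\<omega> k)) {1..n}) \<le> ennreal ((\<Sum>k=1..n. Y k (\<omega> k)) + l)"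
          unfolding Y_def using X0 l(1) by (intro ennreal_leI L2_set_le_truncated_sum) auto
        also have "\<dots> = (\<Sum>k=1..n. ennreal (Y k (\<omega> k))) + ennreal l"
          using Y0 l by (simp add: ennreal_plus sum_nonneg sum_ennreal)
        finally show "ennreal (L2_set (\<lambda>k. X k (\<omega> k)) {1..n})
            \<le> (\<Sum>k=1..n. ennreal (Y k (\<omega> k))) + ennreal l" .
      qed
      also have "\<dots> = (\<Sum>k=1..n. \<integral>\<^sup>+\<omega>. ennreal (Y k (\<omega> k)) \<partial>?M) + ennreal l"
      proof -
        have "(\<lambda>\<omega>. \<Sum>k=1..n. ennreal (Y k (\<omega> k))) \<in> borel_measurable ?M"
          by (rule borel_measurable_sum) (rule measY)
        moreover have "(\<integral>\<^sup>+\<omega>. (\<Sum>k=1..n. ennreal (Y k (\<omega> k))) \<partial>?M)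
            = (\<Sum>k=1..n. \<integral>\<^sup>+\<omega>. ennreal (Y k (\<omega> k)) \<partial>?M)"
          by (rule nn_integral_sum) (rule measY)
        ultimately show ?thesis
          by (simp add: nn_integral_add emeasure_space_1 del: sum_ennreal)
      qed
      also have "(\<Sum>k=1..n. \<integral>\<^sup>+\<omega>. ennreal (Y k (\<omega> k)) \<partial>?M)
          = (\<Sum>k=1..n. ennreal (integral {0..1} (Y k)))"
        by (intro sum.cong refl nn_integral_PiM_torus_component contY Y0) auto
      also have "\<dots> + ennreal l = ennreal ((\<Sum>k=1..n. integral {0..1} (Y k)) + l)"
      proof -
        have "(\<Sum>k=1..n. integral {0..1} (Y k)) \<ge> 0"
          by (intro sum_nonneg intY) auto
        moreover have "(\<Sum>k=1..n. ennreal (integral {0..1} (Y k)))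
            = ennreal (\<Sum>k=1..n. integral {0..1} (Y k))"
          by (intro sum_ennreal intY) auto
        ultimately show ?thesis using l by (simp del: sum_ennreal)
      qed
      also have "\<dots> \<le> ennreal ((C + 1) * l)"
        using sum by (intro ennreal_leI) (simp add: algebra_simps)
      finally show ?thesis .
    qed
    have "(\<integral>\<^sup>+\<omega>. ennreal (L2_set (\<lambda>k. X k (\<omega> k)) {1..n}) \<partial>?M) \<le> ennreal (C + 1) * L" for n
    proof (cases L)
      case top
      then show ?thesis using C by (simp add: ennreal_mult_top)
    next
      case (real r)
      show ?thesis
      proof (rule ennreal_le_epsilon)
        fix e :: real assume e: "e > 0"
        \<comment> \<open>Positive even for \<open>r = 0\<close>, and chosen so that the excess in
          the final bound is exactly \<open>e\<close>.\<close>
        define l where "l = r + e / (C + 1)"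
        have "l > 0" "L \<le> ennreal l" using e real C by (auto simp: l_def intro!: ennreal_leI add_nonneg_pos)
        then have "(\<integral>\<^sup>+\<omega>. ennreal (L2_set (\<lambda>k. X k (\<omega> k)) {1..n}) \<partial>?M) \<le> ennreal ((C + 1) * l)"
          by (rule bound)
        also have "(C + 1) * l = (C + 1) * r + e" using C by (simp add: l_def field_simps)
        also have "ennreal \<dots> = ennreal (C + 1) * L + ennreal e"
          using real C e by (simp add: ennreal_plus ennreal_mult)
        finally show "(\<integral>\<^sup>+\<omega>. ennreal (L2_set (\<lambda>k. X k (\<omega> k)) {1..n}) \<partial>?M)
            \<le> ennreal (C + 1) * L + ennreal e" .
      qed
    qed
    then have "ind_norm X \<le> ennreal (C + 1) * L"
      by (subst ind_norm_eq_SUP) (auto intro!: SUP_least contX)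
    then show ?thesis by (simp add: X_def[abs_def] L_def)
  qed
  with C show ?thesis by (intro exI[of _ "C + 1"]) auto
qed

end
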